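(* Let $r\in\mathbb{N}$ and $m_1,\ldots,m_r\in\mathbb{N}$. The number of cyclic subgroups of the group $C_{m_1}\times\cdots\times C_{m_r}$ is \[ c(C_{m_1}\times\cdots\times C_{m_r})=\sum_{d_1\mid m_1,\ldots,d_r\mid m_r}\frac{\phi(d_1)\cdots\phi(d_r)}{\phi(\operatorname{lcm}[d_1,\ldots,d_r])}, \] and $(m_1,\ldots,m_r)\mapsto c(C_{m_1}\times\cdots\times C_{m_r})$ is a multiplicative function of $r$ variables. In particular, \[ c(C_{m_1}\times C_{m_2})=\sum_{d_1\mid m_1,\,d_2\mid m_2}\phi(\gcd(d_1,d_2)), \] and for every prime $p$ and all $u,v\in\mathbb{N}$ with $u\ge v$, \[ c(C_{p^u}\times C_{p^v})=2\left(1+p+p^2+\cdots+p^{v-1}\right)+(u-v+1)p^v . \]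
   Context: $\mathbb{N}=\{1,2,\ldots\}$. $C_n$ denotes the cyclic group of order $n$, and $c(G)$ denotes the number of cyclic subgroups of a finite group $G$. $\phi$ is Euler's totient function. A function $f:\mathbb{N}^r\to\mathbb{C}$ is called multiplicative if it is not identically zero and $f(m_1n_1,\ldots,m_rn_r)=f(m_1,\ldots,m_r)f(n_1,\ldots,n_r)$ for all $m_1,\ldots,m_r,n_1,\ldots,n_r\in\mathbb{N}$ with $\gcd(m_1\cdots m_r,n_1\cdots n_r)=1$. *)

theory Defs
  imports "HOL-Algebra.Product_Groups" "HOL-Number_Theory.Totient" Complex_Main
begin

definition cyclic_subgroups :: "('a, 'b) monoid_scheme \<Rightarrow> 'a set set" where
  "cyclic_subgroups G = {H. subgroup H G \<and> cyclic_group (G\<lparr>carrier := H\<rparr>)}"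

definition num_cyclic_subgroups :: "('a, 'b) monoid_scheme \<Rightarrow> nat" where
  "num_cyclic_subgroups G = card (cyclic_subgroups G)"

text \<open>Tuples in \<open>\<nat>\<^sup>r\<close> with \<open>\<nat> = {1, 2, \<dots>}\<close>, as functions that are \<^const>\<open>undefined\<close> outside
  \<open>{1..r}\<close>.\<close>

definition pos_tuples :: "nat \<Rightarrow> (nat \<Rightarrow> nat) set" where
  "pos_tuples r = ({1..r} \<rightarrow>\<^sub>E {1..})"

definition multiplicative_function :: "nat \<Rightarrow> ((nat \<Rightarrow> nat) \<Rightarrow> complex) \<Rightarrow> bool" where
  "multiplicative_function r f \<longleftrightarrow>
     (\<exists>m\<in>pos_tuples r. f m \<noteq> 0) \<and>
     (\<forall>m\<in>pos_tuples r. \<forall>n\<in>pos_tuples r.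
        gcd (\<Prod>i=1..r. m i) (\<Prod>i=1..r. n i) = 1 \<longrightarrow>
        f (\<lambda>i\<in>{1..r}. m i * n i) = f m * f n)"

text \<open>The group \<open>C\<^bsub>m 1\<^esub> \<times> \<dots> \<times> C\<^bsub>m r\<^esub>\<close>; note that \<^term>\<open>integer_mod_group n\<close> is cyclic of order
  \<open>n\<close> only for positive \<open>n\<close> (for \<open>n = 0\<close> it is infinite cyclic).\<close>

definition cyclic_product :: "nat \<Rightarrow> (nat \<Rightarrow> nat) \<Rightarrow> (nat \<Rightarrow> int) monoid" where
  "cyclic_product r m = product_group {1..r} (\<lambda>i. integer_mod_group (m i))"

end

theory Submission
  imports Defs "HOL-Algebra.Multiplicative_Group"
begin

text \<open>
  A cyclic subgroup with \<open>n\<close> elements has \<open>\<phi>(n)\<close> generators, so the number of cyclic subgroups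
  of a finite group is the sum of \<open>1 / \<phi>(ord x)\<close> over its elements. In a product the order of a
  tuple is the lcm of the orders of its components, and \<open>C\<^bsub>m\<^esub>\<close> has \<open>\<phi>(d)\<close> elements of order \<open>d\<close> for
  every \<open>d\<close> dividing \<open>m\<close>; grouping the elements by the orders of their components gives the formula.
  Multiplicativity holds because a divisor of \<open>m\<^sub>i n\<^sub>i\<close> factors uniquely into divisors of the coprime
  numbers \<open>m\<^sub>i\<close> and \<open>n\<^sub>i\<close>. For two factors, \<open>\<phi>(a) \<phi>(b) = \<phi>(gcd a b) \<phi>(lcm a b)\<close>.
\<close>

section \<open>Cyclic subgroups of a finite group and their generators\<close>

lemma (in group) cyclic_subgroups_eq:
  "cyclic_subgroups G = (\<lambda>x. generate G {x}) ` carrier G"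
proof (intro equalityI subsetI)
  fix H assume "H \<in> cyclic_subgroups G"
  then have H: "subgroup H G" and "cyclic_group (G\<lparr>carrier := H\<rparr>)"
    by (auto simp: cyclic_subgroups_def)
  then obtain x where x: "x \<in> H" and "subgroup_generated (G\<lparr>carrier := H\<rparr>) {x} = G\<lparr>carrier := H\<rparr>"
    by (auto simp: cyclic_group_def)
  then have "carrier (subgroup_generated (G\<lparr>carrier := H\<rparr>) {x}) = H"
    by simp
  \<comment> \<open>By \<open>generate_consistent\<close>, an element of \<open>H\<close> generates
    the same set inside \<open>H\<close> as inside \<open>G\<close>.\<close>
  then have "H = generate G {x}"
    using generate_consistent[OF _ H, of "{x}"] x by (simp add: carrier_subgroup_generated)
  then show "H \<in> (\<lambda>x. generate G {x}) ` carrier G"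
    using subgroup.mem_carrier[OF H x] by blast
next
  fix H assume "H \<in> (\<lambda>x. generate G {x}) ` carrier G"
  then obtain x where x: "x \<in> carrier G" and H: "H = generate G {x}"
    by blast
  have "subgroup H G"
    using x unfolding H by (intro generate_is_subgroup) auto
  moreover have "cyclic_group (G\<lparr>carrier := H\<rparr>)"
    using cyclic_group_generated[of x] x by (simp add: subgroup_generated_def H)
  ultimately show "H \<in> cyclic_subgroups G"
    by (simp add: cyclic_subgroups_def)
qed

text \<open>The generators of the subgroup spanned by \<open>x\<close> are the powers of
  \<open>x\<close> whose exponent is coprime to \<open>ord x\<close>, and exponents in
  \<open>totatives (ord x)\<close> list them without repetition.\<close>

lemma (in group) card_generators:
  assumes fin: "finite (carrier G)" and x: "x \<in> carrier G"
  shows "card {y \<in> carrier G. generate G {y} = generate G {x}} = totient (ord x)"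
proof -
  have ord_pos: "0 < ord x"
    using ord_ge_1[OF fin x] by simp
  have gen: "generate G {x} = {x [^] k |k. k \<in> (UNIV :: nat set)}"
    using generate_pow_on_finite_carrier[OF fin x] .
  have pow_gen: "generate G {x [^] k} = generate G {x} \<longleftrightarrow> coprime k (ord x)" for k :: nat
  proof -
    have sub: "generate G {x [^] k} \<subseteq> generate G {x}"
      using x gen by (intro generate_subgroup_incl generate_is_subgroup) auto
    have "generate G {x} \<subseteq> carrier G"
      using x by (intro generate_incl) auto
    then have "finite (generate G {x})"
      using fin finite_subset by blast
    \<comment> \<open>Of two nested finite sets, the smaller is the whole as soon as the
      cardinalities agree, and the cardinality of a generated subgroup is the order of its
      generator.\<close>
    then have "generate G {x [^] k} = generate G {x} \<longleftrightarrow> ord (x [^] k) = ord x"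
      using sub x by (metis card_subset_eq generate_pow_card nat_pow_closed)
    then show ?thesis
      using pow_ord_eq_ord_iff[OF fin x] by simp
  qed
  have "{y \<in> carrier G. generate G {y} = generate G {x}} = (\<lambda>k. x [^] k) ` totatives (ord x)"
  proof (intro equalityI subsetI)
    fix y assume "y \<in> {y \<in> carrier G. generate G {y} = generate G {x}}"
    then have y: "y \<in> carrier G" "generate G {y} = generate G {x}"
      by auto
    then have "y \<in> generate G {x}"
      using generate.incl[of y "{y}" G] by simp
    then obtain k :: nat where k: "y = x [^] k"
      using gen by blast
    \<comment> \<open>\<open>totatives n\<close> lies in \<open>{0<..n}\<close>, so the residue 0 is
      represented by \<open>ord x\<close> itself. This covers the trivial subgroup, where
      \<open>ord x = 1\<close> and the only totative is 1.\<close>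
    define l where "l = (if k mod ord x = 0 then ord x else k mod ord x)"
    have "int (ord x) dvd int l - int k"
      by (auto simp: l_def mod_eq_0_iff_dvd zmod_int simp flip: mod_eq_dvd_iff)
    then have "y = x [^] l"
      using int_pow_eq[OF x, of "int k" "int l"] by (simp add: k int_pow_int)
    moreover have "l \<in> totatives (ord x)"
      using y(2) pow_gen[of l] ord_pos mod_less_divisor[OF ord_pos, of k] \<open>y = x [^] l\<close>
      by (auto simp: in_totatives_iff l_def split: if_splits)
    ultimately show "y \<in> (\<lambda>k. x [^] k) ` totatives (ord x)"
      by blast
  next
    fix y assume "y \<in> (\<lambda>k. x [^] k) ` totatives (ord x)"
    then obtain k where "y = x [^] k" "coprime k (ord x)"
      by (auto simp: in_totatives_iff)
    then show "y \<in> {y \<in> carrier G. generate G {y} = generate G {x}}"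
      using x pow_gen[of k] by simp
  qed
  moreover have "inj_on (\<lambda>k. x [^] k) (totatives (ord x))"
    by (rule inj_on_subset[OF ord_inj'[OF x]]) (auto simp: in_totatives_iff)
  ultimately show ?thesis
    by (simp add: card_image totient_def)
qed

lemma (in group) num_cyclic_subgroups_eq_sum:
  assumes fin: "finite (carrier G)"
  shows "real (num_cyclic_subgroups G) = (\<Sum>x\<in>carrier G. 1 / real (totient (ord x)))"
proof -
  have "(\<Sum>x\<in>carrier G. 1 / real (totient (ord x))) =
      (\<Sum>H\<in>(\<lambda>x. generate G {x}) ` carrier G.
        \<Sum>y | y \<in> carrier G \<and> generate G {y} = H. 1 / real (totient (ord y)))"
    by (rule sum.image_gen[OF fin])
  \<comment> \<open>The fibre over \<open>H\<close> consists of the generators of \<open>H\<close>.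
    They share one order, and their number cancels the denominator.\<close>
  also have "\<dots> = (\<Sum>H\<in>(\<lambda>x. generate G {x}) ` carrier G. 1)"
  proof (intro sum.cong refl)
    fix H assume "H \<in> (\<lambda>x. generate G {x}) ` carrier G"
    then obtain x where x: "x \<in> carrier G" and H: "H = generate G {x}"
      by blast
    have "(\<Sum>y | y \<in> carrier G \<and> generate G {y} = H. 1 / real (totient (ord y))) =
        (\<Sum>y | y \<in> carrier G \<and> generate G {y} = H. 1 / real (totient (ord x)))"
      using x by (intro sum.cong refl) (auto simp: H generate_pow_card)
    also have "\<dots> = 1"
      using card_generators[OF fin x] ord_ge_1[OF fin x] by (simp add: H)
    finally show "(\<Sum>y | y \<in> carrier G \<and> generate G {y} = H. 1 / real (totient (ord y))) = 1" .
  qed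
  finally show ?thesis
    by (simp add: num_cyclic_subgroups_def cyclic_subgroups_eq)
qed

section \<open>Element orders in a finite cyclic group\<close>

lemma finite_carrier_integer_mod_group:
  "m > 0 \<Longrightarrow> finite (carrier (integer_mod_group m))"
  by (simp add: carrier_integer_mod_group)

lemma ord_integer_mod_group:
  assumes "m > 0" and "k < m"
  shows "group.ord (integer_mod_group m) (int k) = m div gcd k m"
proof -
  interpret group "integer_mod_group m" by simp
  have "m dvd n * k \<longleftrightarrow> m div gcd k m dvd n" for n
  proof -
    \<comment> \<open>After division by the gcd, \<open>b\<close> divides \<open>n * a\<close> with
      \<open>a\<close> and \<open>b\<close> coprime, so \<open>b\<close> divides \<open>n\<close>;
      and \<open>b\<close> is \<open>m div gcd k m\<close>.\<close>
    obtain a b where ab: "k = a * gcd k m" "m = b * gcd k m" "coprime a b"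
      using gcd_coprime_exists[of k m] assms by auto
    define g where "g = gcd k m"
    have "g > 0" "k = a * g" "m = b * g"
      using assms ab by (auto simp: g_def)
    then show ?thesis
      using ab(3) unfolding g_def[symmetric]
      by (simp add: coprime_commute coprime_dvd_mult_left_iff flip: mult.assoc)
  qed
  then have "int n * int k mod int m = 0 \<longleftrightarrow> m div gcd k m dvd n" for n
    by (simp flip: of_nat_mult zmod_int) (simp add: mod_eq_0_iff_dvd)
  then show ?thesis
    using assms by (subst ord_unique) (auto simp: carrier_integer_mod_group)
qed

text \<open>By the order formula, the residue of \<open>k\<close> has order \<open>d\<close> exactly
  when \<open>gcd k m\<close> is the complementary divisor \<open>m div d\<close>. The library fact
  \<open>card_gcd_eq_totient\<close> counts such \<open>k\<close>.\<close>

lemma card_ord_integer_mod_group: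
  assumes "m > 0" and d: "d dvd m"
  shows "card {x \<in> carrier (integer_mod_group m). group.ord (integer_mod_group m) x = d} = totient d"
proof -
  have eq: "m div gcd k m = d \<longleftrightarrow> gcd k m = m div d" for k
    using assms by (metis div_div_eq_right div_mult_self1_is_m dvd_div_mult_self dvd_mult_div_cancel gcd_dvd2 dvd_div_eq_mult dvd_pos_nat mult.commute)
  \<comment> \<open>The group uses the representatives 0 to m - 1, the totient count uses 1 to m.
    Reduction mod \<open>m\<close> matches them, sending \<open>m\<close> to the identity 0.\<close>
  have "{x \<in> carrier (integer_mod_group m). group.ord (integer_mod_group m) x = d} =
      (\<lambda>k. int (k mod m)) ` {k \<in> {0<..m}. gcd k m = m div d}"
  proof (intro equalityI subsetI)
    fix x assume "x \<in> {x \<in> carrier (integer_mod_group m). group.ord (integer_mod_group m) x = d}"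
    then obtain k where "x = int k" "k < m" "group.ord (integer_mod_group m) (int k) = d"
      using assms by (auto simp: carrier_integer_mod_group elim!: nonneg_int_cases)
    then have k: "x = int k" "k < m" "gcd k m = m div d"
      using assms ord_integer_mod_group[of m k] eq by auto
    then show "x \<in> (\<lambda>k. int (k mod m)) ` {k \<in> {0<..m}. gcd k m = m div d}"
      using assms by (intro image_eqI[of _ _ "if k = 0 then m else k"]) auto
  next
    fix x assume "x \<in> (\<lambda>k. int (k mod m)) ` {k \<in> {0<..m}. gcd k m = m div d}"
    then obtain k where k: "x = int (k mod m)" "gcd k m = m div d"
      by blast
    have "gcd (k mod m) m = gcd k m"
      by (metis gcd.commute gcd_red_nat)
    then show "x \<in> {x \<in> carrier (integer_mod_group m). group.ord (integer_mod_group m) x = d}"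
      using assms k ord_integer_mod_group[of m "k mod m"] eq
      by (auto simp: carrier_integer_mod_group)
  qed
  moreover have "inj_on (\<lambda>k. int (k mod m)) {k \<in> {0<..m}. gcd k m = m div d}"
  proof (rule inj_onI)
    fix j k assume "j \<in> {k \<in> {0<..m}. gcd k m = m div d}" "k \<in> {k \<in> {0<..m}. gcd k m = m div d}"
      and "int (j mod m) = int (k mod m)"
    then show "j = k"
      by (cases "j = m"; cases "k = m") auto
  qed
  ultimately have "card {x \<in> carrier (integer_mod_group m). group.ord (integer_mod_group m) x = d} =
      totient (m div (m div d))"
    using assms card_gcd_eq_totient[of m "m div d"] by (auto simp: card_image div_dvd_iff_mult)
  also have "m div (m div d) = d"
    using assms by (metis div_div_eq_right div_self gr_implies_not0 mult_1 dvd_refl nonzero_mult_div_cancel_right)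
  finally show ?thesis .
qed

lemma ord_integer_mod_group_dvd:
  assumes "m > 0" and "x \<in> carrier (integer_mod_group m)"
  shows "group.ord (integer_mod_group m) x dvd m"
  using assms ord_integer_mod_group[of m "nat x"]
  by (auto simp: carrier_integer_mod_group nat_less_iff div_dvd_iff_mult)

text \<open>Grouping elements by order. For a product of two cyclic groups this is applied once to
  each component.\<close>

lemma sum_ord_integer_mod_group:
  fixes F :: "nat \<Rightarrow> real"
  assumes "m > 0"
  shows "(\<Sum>x\<in>carrier (integer_mod_group m). F (group.ord (integer_mod_group m) x)) =
         (\<Sum>d | d dvd m. real (totient d) * F d)"
proof -
  let ?C = "carrier (integer_mod_group m)" and ?ord = "group.ord (integer_mod_group m)"
  have "(\<Sum>x\<in>?C. F (?ord x)) = (\<Sum>d | d dvd m. \<Sum>x\<in>{x \<in> ?C. ?ord x = d}. F (?ord x))"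
    using assms ord_integer_mod_group_dvd finite_carrier_integer_mod_group
    by (intro sum.group[symmetric]) auto
  also have "\<dots> = (\<Sum>d | d dvd m. real (totient d) * F d)"
    using assms by (intro sum.cong refl) (simp add: card_ord_integer_mod_group)
  finally show ?thesis .
qed

section \<open>Orders in direct products and the divisor sums\<close>

lemma ord_DirProd:
  assumes "group G" "group H" "x \<in> carrier G" "y \<in> carrier H"
  shows "group.ord (G \<times>\<times> H) (x, y) = lcm (group.ord G x) (group.ord H y)"
proof -
  interpret G: group G by fact
  interpret H: group H by fact
  interpret GH: group "G \<times>\<times> H" by (rule DirProd_group) fact+
  have "(x, y) [^]\<^bsub>G \<times>\<times> H\<^esub> n = (x [^]\<^bsub>G\<^esub> n, y [^]\<^bsub>H\<^esub> n)" for n :: nat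
    by (induction n) auto
  then show ?thesis
    using assms by (subst GH.ord_unique) (auto simp: G.pow_eq_id H.pow_eq_id)
qed

text \<open>Powers are taken componentwise, so the \<open>n\<close>-th power is trivial iff every
  component order divides \<open>n\<close>, that is, iff their lcm does. By
  \<open>ord_unique\<close> this determines the order.\<close>

lemma ord_product_group:
  assumes "\<And>i. i \<in> I \<Longrightarrow> group (G i)" and x: "x \<in> (\<Pi>\<^sub>E i\<in>I. carrier (G i))"
  shows "group.ord (product_group I G) x = (LCM i\<in>I. group.ord (G i) (x i))"
proof -
  interpret P: group "product_group I G" using assms by simp
  have "x [^]\<^bsub>product_group I G\<^esub> n = (\<lambda>i\<in>I. x i [^]\<^bsub>G i\<^esub> n)" for n :: nat
    by (induction n) (auto simp: fun_eq_iff)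
  then have "x [^]\<^bsub>product_group I G\<^esub> n = \<one>\<^bsub>product_group I G\<^esub> \<longleftrightarrow>
      (\<forall>i\<in>I. group.ord (G i) (x i) dvd n)" for n :: nat
    using assms group.pow_eq_id[of "G _" "x _" n]
    by (auto simp: fun_eq_iff restrict_def PiE_iff)
  then show ?thesis
    using x by (subst P.ord_unique) (auto simp: Lcm_dvd_iff)
qed

lemma num_cyclic_subgroups_cyclic_product:
  assumes m: "\<And>i. i \<in> {1..r} \<Longrightarrow> m i > 0"
  shows "real (num_cyclic_subgroups (cyclic_product r m)) =
      (\<Sum>d\<in>(\<Pi>\<^sub>E i\<in>{1..r}. {k. k dvd m i}).
         real (\<Prod>i=1..r. totient (d i)) / real (totient (LCM i\<in>{1..r}. d i)))"
proof -
  let ?G = "cyclic_product r m" and ?I = "{1..r}" and ?D = "\<Pi>\<^sub>E i\<in>{1..r}. {k. k dvd m i}"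
  let ?ord = "\<lambda>i. group.ord (integer_mod_group (m i))"
  \<comment> \<open>\<open>?T\<close> records the component orders. The sum over group elements is
    split along its fibres, which are indexed by tuples of divisors.\<close>
  let ?T = "\<lambda>x. \<lambda>i\<in>?I. ?ord i (x i)"
  interpret group ?G
    by (simp add: cyclic_product_def)
  have car: "carrier ?G = (\<Pi>\<^sub>E i\<in>?I. carrier (integer_mod_group (m i)))"
    by (simp add: cyclic_product_def)
  have fin: "finite (carrier ?G)"
    unfolding car using m by (intro finite_PiE finite_carrier_integer_mod_group) auto
  have ord_eq: "ord x = (LCM i\<in>?I. ?T x i)" if "x \<in> carrier ?G" for x
    using that by (simp add: cyclic_product_def ord_product_group)
  have "real (num_cyclic_subgroups ?G) = (\<Sum>x\<in>carrier ?G. 1 / real (totient (ord x)))"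
    by (rule num_cyclic_subgroups_eq_sum[OF fin])
  also have "\<dots> = (\<Sum>d\<in>?D. \<Sum>x\<in>{x \<in> carrier ?G. ?T x = d}. 1 / real (totient (ord x)))"
  proof (rule sum.group[symmetric])
    show "finite ?D"
      using m by (intro finite_PiE) auto
    show "?T ` carrier ?G \<subseteq> ?D"
      unfolding car using m ord_integer_mod_group_dvd by (fastforce simp: PiE_iff)
  qed (rule fin)
  also have "\<dots> = (\<Sum>d\<in>?D.
      real (\<Prod>i=1..r. totient (d i)) / real (totient (LCM i\<in>{1..r}. d i)))"
  proof (intro sum.cong refl)
    fix d assume d: "d \<in> ?D"
    \<comment> \<open>Each component is constrained separately, so the fibre is again a product and
      its size is a product of totients.\<close>
    have "{x \<in> carrier ?G. ?T x = d} =
        (\<Pi>\<^sub>E i\<in>?I. {x \<in> carrier (integer_mod_group (m i)). ?ord i x = d i})"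
      unfolding car using d by (auto simp: PiE_iff fun_eq_iff extensional_def restrict_def)
    then have "card {x \<in> carrier ?G. ?T x = d} = (\<Prod>i=1..r. totient (d i))"
      using d m by (auto simp: card_PiE PiE_iff intro!: prod.cong card_ord_integer_mod_group)
    moreover have "(\<Sum>x\<in>{x \<in> carrier ?G. ?T x = d}. 1 / real (totient (ord x))) =
        (\<Sum>x\<in>{x \<in> carrier ?G. ?T x = d}. 1 / real (totient (LCM i\<in>?I. d i)))"
      using ord_eq by (intro sum.cong refl) auto
    ultimately show "(\<Sum>x\<in>{x \<in> carrier ?G. ?T x = d}. 1 / real (totient (ord x))) =
        real (\<Prod>i=1..r. totient (d i)) / real (totient (LCM i\<in>?I. d i))"
      by simp
  qed
  finally show ?thesis .
qed

text \<open>Proved directly for pairs: the carrier of \<open>cyclic_product 2 m\<close> consists of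
  functions, so that group is only isomorphic to this one. The identity
  \<open>totient_gcd_lcm\<close> then removes the fractions.\<close>

lemma num_cyclic_subgroups_DirProd:
  assumes "m > 0" "n > 0"
  shows "num_cyclic_subgroups (integer_mod_group m \<times>\<times> integer_mod_group n) =
      (\<Sum>a | a dvd m. \<Sum>b | b dvd n. totient (gcd a b))"
proof -
  let ?M = "integer_mod_group m" and ?N = "integer_mod_group n"
  interpret group "?M \<times>\<times> ?N"
    by (simp add: DirProd_group)
  have "real (num_cyclic_subgroups (?M \<times>\<times> ?N)) =
      (\<Sum>z\<in>carrier ?M \<times> carrier ?N. 1 / real (totient (ord z)))"
    using assms by (subst num_cyclic_subgroups_eq_sum) (auto simp: finite_carrier_integer_mod_group)
  also have "\<dots> = (\<Sum>x\<in>carrier ?M. \<Sum>y\<in>carrier ?N.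
      1 / real (totient (lcm (group.ord ?M x) (group.ord ?N y))))"
    by (subst sum.cartesian_product) (auto simp: ord_DirProd intro!: sum.cong)
  also have "\<dots> = (\<Sum>a | a dvd m. \<Sum>b | b dvd n.
      real (totient a) * (real (totient b) * (1 / real (totient (lcm a b)))))"
    using assms
    by (simp only: sum_ord_integer_mod_group[where F = "\<lambda>b. 1 / real (totient (lcm _ b))"]
        sum_ord_integer_mod_group[where F = "\<lambda>a. \<Sum>b | b dvd n. real (totient b) * (1 / real (totient (lcm a b)))"]
        sum_distrib_left)
  also have "\<dots> = (\<Sum>a | a dvd m. \<Sum>b | b dvd n. real (totient (gcd a b)))"
  proof (intro sum.cong refl)
    fix a b assume "a \<in> {a. a dvd m}" "b \<in> {b. b dvd n}"
    \<comment> \<open>A nonzero lcm has a nonzero totient, so the cancellation below is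
      legitimate.\<close>
    then have "lcm a b \<noteq> 0"
      using assms by (auto simp: lcm_eq_0_iff)
    moreover have "real (totient a) * real (totient b) = real (totient (gcd a b)) * real (totient (lcm a b))"
      by (metis of_nat_mult totient_gcd_lcm)
    ultimately show "real (totient a) * (real (totient b) * (1 / real (totient (lcm a b)))) =
        real (totient (gcd a b))"
      by (simp add: field_simps)
  qed
  finally show ?thesis
    by (simp flip: of_nat_sum)
qed

section \<open>Evaluation at prime powers\<close>

lemma sum_totient_prime_power:
  "prime p \<Longrightarrow> (\<Sum>i\<le>k. totient (p ^ i)) = p ^ k"
proof (induction k)
  case (Suc k)
  \<comment> \<open>The totients telescope: \<open>totient (p ^ Suc k)\<close> is the difference of
    consecutive powers, written additively to avoid truncated subtraction.\<close>
  then have "p ^ k + totient (p ^ Suc k) = p ^ Suc k"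
    using prime_gt_0_nat[of p] by (cases p) (simp_all add: totient_prime_power_Suc del: power_Suc, simp)
  with Suc show ?case
    by simp
qed simp

text \<open>Induction on \<open>v\<close> with \<open>u\<close> fixed. The new column
  \<open>b = Suc v\<close> contributes \<open>totient (p ^ a)\<close> for \<open>a \<le> v\<close>,
  which add up to \<open>p ^ v\<close>, and \<open>totient (p ^ Suc v)\<close> for each of the
  remaining \<open>u - v\<close> values of \<open>a\<close>.\<close>

lemma sum_totient_gcd_prime_powers:
  assumes p: "prime p" and "v \<le> u"
  shows "(\<Sum>a\<le>u. \<Sum>b\<le>v. totient (gcd (p ^ a) (p ^ b))) =
      2 * (\<Sum>i<v. p ^ i) + (u - v + 1) * p ^ v"
  using \<open>v \<le> u\<close>
proof (induction v)
  case 0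
  then show ?case
    by simp
next
  case (Suc v)
  \<comment> \<open>Writing \<open>u\<close> as \<open>Suc v + w\<close>, and later \<open>p\<close>
    as \<open>Suc q\<close>, turns the natural subtractions into plain polynomial algebra.\<close>
  define w where "w = u - Suc v"
  have u: "u = Suc v + w"
    using Suc by (simp add: w_def)
  have "(\<Sum>a\<le>u. totient (gcd (p ^ a) (p ^ Suc v))) =
      (\<Sum>a\<le>v. totient (gcd (p ^ a) (p ^ Suc v))) + (\<Sum>a\<in>{v<..u}. totient (gcd (p ^ a) (p ^ Suc v)))"
    using Suc by (subst sum.union_disjoint[symmetric]) (auto intro!: sum.cong)
  also have "(\<Sum>a\<le>v. totient (gcd (p ^ a) (p ^ Suc v))) = (\<Sum>a\<le>v. totient (p ^ a))"
    by (intro sum.cong refl) (simp add: gcd_nat.absorb1 le_imp_power_dvd del: power_Suc)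
  also have "\<dots> = p ^ v"
    by (rule sum_totient_prime_power[OF p])
  also have "(\<Sum>a\<in>{v<..u}. totient (gcd (p ^ a) (p ^ Suc v))) = (\<Sum>a\<in>{v<..u}. p ^ v * (p - 1))"
    using p by (intro sum.cong refl)
      (simp add: gcd_nat.absorb2 le_imp_power_dvd totient_prime_power_Suc del: power_Suc)
  also have "\<dots> = (u - v) * (p ^ v * (p - 1))"
    by simp
  finally have step: "(\<Sum>a\<le>u. totient (gcd (p ^ a) (p ^ Suc v))) = p ^ v + (u - v) * (p ^ v * (p - 1))" .
  obtain q where q: "p = Suc q"
    using p by (metis not_prime_0 not0_implies_Suc)
  have "(\<Sum>a\<le>u. \<Sum>b\<le>Suc v. totient (gcd (p ^ a) (p ^ b))) =
      (\<Sum>a\<le>u. \<Sum>b\<le>v. totient (gcd (p ^ a) (p ^ b))) + (\<Sum>a\<le>u. totient (gcd (p ^ a) (p ^ Suc v)))"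
    by (simp add: sum.distrib)
  also have "\<dots> = 2 * (\<Sum>i<v. p ^ i) + (u - v + 1) * p ^ v + (p ^ v + (u - v) * (p ^ v * (p - 1)))"
    using Suc step by simp
  also have "\<dots> = 2 * (\<Sum>i<Suc v. p ^ i) + (u - Suc v + 1) * p ^ Suc v"
    by (simp add: u q algebra_simps)
  finally show ?case .
qed

lemma sum_dvd_prime_power:
  fixes p :: nat
  assumes "prime p"
  shows "(\<Sum>d | d dvd p ^ k. f d) = (\<Sum>i\<le>k. f (p ^ i))"
proof -
  have "{d. d dvd p ^ k} = (\<lambda>i. p ^ i) ` {..k}"
    using assms by (auto simp: divides_primepow_nat)
  moreover have "inj_on (\<lambda>i. p ^ i) {..k}"
    using prime_gt_1_nat[OF assms] by (auto intro!: inj_onI)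
  ultimately show ?thesis
    by (simp add: sum.reindex)
qed

section \<open>Multiplicativity\<close>

lemma Lcm_mult_coprime:
  fixes a b :: "'i \<Rightarrow> nat"
  assumes "finite I" "\<And>i j. i \<in> I \<Longrightarrow> j \<in> I \<Longrightarrow> coprime (a i) (b j)"
  shows "(LCM i\<in>I. a i * b i) = (LCM i\<in>I. a i) * (LCM i\<in>I. b i)"
    and "coprime (LCM i\<in>I. a i) (LCM i\<in>I. b i)"
proof -
  \<comment> \<open>The lcm of a finite family divides its product, which inherits coprimality to
    \<open>c\<close> from the factors. Used once for each side.\<close>
  have cop: "coprime (Lcm (f ` J)) c" if "finite J" "\<And>i. i \<in> J \<Longrightarrow> coprime (f i) c"
    for f :: "'i \<Rightarrow> nat" and J c
    by (rule coprime_divisors[of _ "prod f J" c c])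
      (use that in \<open>auto intro!: Lcm_least dvd_prodI prod_coprime_left\<close>)
  show c: "coprime (LCM i\<in>I. a i) (LCM i\<in>I. b i)"
    using assms by (meson cop coprime_commute)
  show "(LCM i\<in>I. a i * b i) = (LCM i\<in>I. a i) * (LCM i\<in>I. b i)"
  proof (rule dvd_antisym)
    show "(LCM i\<in>I. a i * b i) dvd (LCM i\<in>I. a i) * (LCM i\<in>I. b i)"
      by (auto intro!: Lcm_least mult_dvd_mono)
    \<comment> \<open>Both factors divide the right-hand side, and being coprime, so does their
      product.\<close>
    show "(LCM i\<in>I. a i) * (LCM i\<in>I. b i) dvd (LCM i\<in>I. a i * b i)"
    proof (intro divides_mult c Lcm_least)
      fix x assume "x \<in> a ` I"
      then obtain i where "i \<in> I" "x = a i"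
        by blast
      then show "x dvd (LCM i\<in>I. a i * b i)"
        by (intro dvd_trans[OF dvd_triv_left[of x "b i"]] dvd_Lcm) auto
    next
      fix x assume "x \<in> b ` I"
      then obtain i where "i \<in> I" "x = b i"
        by blast
      then show "x dvd (LCM i\<in>I. a i * b i)"
        by (intro dvd_trans[OF dvd_triv_right[of x "a i"]] dvd_Lcm) auto
    qed
  qed
qed

text \<open>The inverse recovers the two factors of \<open>d i\<close> as its gcds with
  \<open>m i\<close> and \<open>n i\<close>.\<close>

lemma bij_betw_mult_divisors:
  fixes m n :: "'i \<Rightarrow> nat"
  assumes "\<And>i. i \<in> I \<Longrightarrow> coprime (m i) (n i)"
  shows "bij_betw (\<lambda>(a, b). \<lambda>i\<in>I. a i * b i)
      ((\<Pi>\<^sub>E i\<in>I. {k. k dvd m i}) \<times> (\<Pi>\<^sub>E i\<in>I. {k. k dvd n i}))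
      (\<Pi>\<^sub>E i\<in>I. {k. k dvd m i * n i})"
proof -
  have g: "gcd (x * y) k = x" if "x dvd k" "y dvd l" "coprime k l" for x y k l :: nat
  proof -
    have "coprime y k"
      using that by (meson coprime_commute coprime_divisors dvd_refl)
    then show ?thesis
      using that by (metis coprime_commute gcd_mult_left_right_cancel gcd_nat.absorb1)
  qed
  show ?thesis
  proof (rule bij_betw_byWitness[where f' = "\<lambda>d. (\<lambda>i\<in>I. gcd (d i) (m i), \<lambda>i\<in>I. gcd (d i) (n i))"])
    show "\<forall>d\<in>\<Pi>\<^sub>E i\<in>I. {k. k dvd m i * n i}.
        (case (\<lambda>i\<in>I. gcd (d i) (m i), \<lambda>i\<in>I. gcd (d i) (n i)) of (a, b) \<Rightarrow> \<lambda>i\<in>I. a i * b i) = d"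
    proof
      fix d assume d: "d \<in> (\<Pi>\<^sub>E i\<in>I. {k. k dvd m i * n i})"
      have "gcd (d i) (m i) * gcd (d i) (n i) = d i" if "i \<in> I" for i
      proof -
        have "d i dvd m i * n i"
          using d that by (auto simp: PiE_iff)
        \<comment> \<open>Some factorization exists by \<open>division_decomp\<close>;
          \<open>g\<close> identifies its factors as the two gcds.\<close>
        then obtain a b where "d i = a * b" "a dvd m i" "b dvd n i"
          using division_decomp by blast
        then show ?thesis
          using assms[OF that] g[of a "m i" b "n i"] g[of b "n i" a "m i"]
          by (simp add: mult.commute coprime_commute)
      qed
      then show "(case (\<lambda>i\<in>I. gcd (d i) (m i), \<lambda>i\<in>I. gcd (d i) (n i)) of (a, b) \<Rightarrow> \<lambda>i\<in>I. a i * b i) = d"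
        using d by (auto simp: fun_eq_iff PiE_iff extensional_def)
    qed
  next
    show "\<forall>p\<in>(\<Pi>\<^sub>E i\<in>I. {k. k dvd m i}) \<times> (\<Pi>\<^sub>E i\<in>I. {k. k dvd n i}).
        (\<lambda>i\<in>I. gcd ((case p of (a, b) \<Rightarrow> \<lambda>i\<in>I. a i * b i) i) (m i),
         \<lambda>i\<in>I. gcd ((case p of (a, b) \<Rightarrow> \<lambda>i\<in>I. a i * b i) i) (n i)) = p"
    proof safe
      fix a b assume ab: "a \<in> (\<Pi>\<^sub>E i\<in>I. {k. k dvd m i})" "b \<in> (\<Pi>\<^sub>E i\<in>I. {k. k dvd n i})"
      have "gcd (a i * b i) (m i) = a i" "gcd (a i * b i) (n i) = b i" if "i \<in> I" for i
        using that ab assms[OF that] g[of "a i" "m i" "b i" "n i"] g[of "b i" "n i" "a i" "m i"]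
        by (auto simp: PiE_iff mult.commute coprime_commute)
      then show "(\<lambda>i\<in>I. gcd ((\<lambda>i\<in>I. a i * b i) i) (m i)) = a"
          "(\<lambda>i\<in>I. gcd ((\<lambda>i\<in>I. a i * b i) i) (n i)) = b"
        using ab by (auto simp: fun_eq_iff PiE_iff extensional_def)
    qed
  qed (auto simp: PiE_iff mult_dvd_mono)
qed

text \<open>Under the bijection of divisor tuples the summand \<open>?f\<close> itself splits, since
  totient and lcm both respect coprime products; the double sum then factors.\<close>

lemma num_cyclic_subgroups_cyclic_product_mult:
  assumes m: "\<And>i. i \<in> {1..r} \<Longrightarrow> m i > 0" and n: "\<And>i. i \<in> {1..r} \<Longrightarrow> n i > 0"
    and cop: "coprime (\<Prod>i=1..r. m i) (\<Prod>i=1..r. n i)"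
  shows "num_cyclic_subgroups (cyclic_product r (\<lambda>i\<in>{1..r}. m i * n i)) =
      num_cyclic_subgroups (cyclic_product r m) * num_cyclic_subgroups (cyclic_product r n)"
proof -
  let ?I = "{1..r}"
  let ?D = "\<lambda>m. \<Pi>\<^sub>E i\<in>?I. {k. k dvd m i}"
  let ?f = "\<lambda>d. real (\<Prod>i=1..r. totient (d i)) / real (totient (LCM i\<in>?I. d i))"
  \<comment> \<open>Distinct indices \<open>i\<close> and \<open>j\<close> matter too, because the
    lcm mixes all components.\<close>
  have cop': "coprime (m i) (n j)" if "i \<in> ?I" "j \<in> ?I" for i j
    using cop by (rule coprime_divisors[rotated 2]) (use that in \<open>auto intro!: dvd_prodI\<close>)
  have "real (num_cyclic_subgroups (cyclic_product r (\<lambda>i\<in>?I. m i * n i))) = (\<Sum>d\<in>?D (\<lambda>i\<in>?I. m i * n i). ?f d)"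
    using m n by (intro num_cyclic_subgroups_cyclic_product) auto
  also have "?D (\<lambda>i\<in>?I. m i * n i) = ?D (\<lambda>i. m i * n i)"
    by (intro PiE_cong) simp
  also have "(\<Sum>d\<in>?D (\<lambda>i. m i * n i). ?f d) = (\<Sum>(a, b)\<in>?D m \<times> ?D n. ?f (\<lambda>i\<in>?I. a i * b i))"
    using cop' m n
    by (subst sum.reindex_bij_betw[OF bij_betw_mult_divisors, symmetric]) (auto intro!: sum.cong)
  also have "\<dots> = (\<Sum>(a, b)\<in>?D m \<times> ?D n. ?f a * ?f b)"
  proof (intro sum.cong refl, clarify)
    fix a b assume ab: "a \<in> ?D m" "b \<in> ?D n"
    have c: "coprime (a i) (b j)" if "i \<in> ?I" "j \<in> ?I" for i j
      using ab that by (intro coprime_divisors[OF _ _ cop'[OF that]]) (auto simp: PiE_iff)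
    have "(LCM i\<in>?I. (\<lambda>i\<in>?I. a i * b i) i) = (LCM i\<in>?I. a i * b i)"
      by simp
    then have "totient (LCM i\<in>?I. (\<lambda>i\<in>?I. a i * b i) i) =
        totient (LCM i\<in>?I. a i) * totient (LCM i\<in>?I. b i)"
      using Lcm_mult_coprime[of ?I a b] c by (simp add: totient_mult_coprime)
    moreover have "(\<Prod>i=1..r. totient ((\<lambda>i\<in>?I. a i * b i) i)) =
        (\<Prod>i=1..r. totient (a i)) * (\<Prod>i=1..r. totient (b i))"
      using c by (subst prod.distrib[symmetric]) (auto intro!: prod.cong totient_mult_coprime)
    ultimately show "?f (\<lambda>i\<in>?I. a i * b i) = ?f a * ?f b"
      by simp
  qed
  also have "\<dots> = (\<Sum>a\<in>?D m. ?f a) * (\<Sum>b\<in>?D n. ?f b)"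
    by (simp only: sum_product sum.cartesian_product)
  also have "\<dots> = real (num_cyclic_subgroups (cyclic_product r m) * num_cyclic_subgroups (cyclic_product r n))"
    using m n by (simp only: num_cyclic_subgroups_cyclic_product of_nat_mult)
  finally show ?thesis
    by (simp only: of_nat_eq_iff)
qed

lemma (in group) num_cyclic_subgroups_pos:
  assumes "finite (carrier G)"
  shows "num_cyclic_subgroups G > 0"
  using assms by (auto simp: num_cyclic_subgroups_def cyclic_subgroups_eq card_gt_0_iff)

lemma multiplicative_num_cyclic_subgroups:
  "multiplicative_function r (\<lambda>m. of_nat (num_cyclic_subgroups (cyclic_product r m)))"
  unfolding multiplicative_function_def
proof (intro conjI ballI impI)
  \<comment> \<open>A witness that the function is not identically zero: every finite group has at
    least one cyclic subgroup.\<close>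
  let ?m = "\<lambda>i\<in>{1..r}. 1 :: nat"
  have "finite (carrier (cyclic_product r ?m))"
    unfolding cyclic_product_def carrier_product_group
    by (intro finite_PiE finite_carrier_integer_mod_group) auto
  then have "num_cyclic_subgroups (cyclic_product r ?m) > 0"
    by (intro group.num_cyclic_subgroups_pos) (simp_all add: cyclic_product_def)
  moreover have "?m \<in> pos_tuples r"
    by (auto simp: pos_tuples_def)
  ultimately show "\<exists>m\<in>pos_tuples r. of_nat (num_cyclic_subgroups (cyclic_product r m)) \<noteq> (0 :: complex)"
    by (intro bexI[of _ ?m]) auto
next
  fix m n assume mn: "m \<in> pos_tuples r" "n \<in> pos_tuples r"
    and "gcd (\<Prod>i=1..r. m i) (\<Prod>i=1..r. n i) = 1"
  then have "num_cyclic_subgroups (cyclic_product r (\<lambda>i\<in>{1..r}. m i * n i)) =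
      num_cyclic_subgroups (cyclic_product r m) * num_cyclic_subgroups (cyclic_product r n)"
    by (intro num_cyclic_subgroups_cyclic_product_mult)
      (auto simp: pos_tuples_def PiE_iff Suc_le_eq coprime_iff_gcd_eq_1)
  then show "of_nat (num_cyclic_subgroups (cyclic_product r (\<lambda>i\<in>{1..r}. m i * n i))) =
      (of_nat (num_cyclic_subgroups (cyclic_product r m)) *
       of_nat (num_cyclic_subgroups (cyclic_product r n)) :: complex)"
    by simp
qed

theorem theorem3:
  shows "(\<forall>r::nat. r \<ge> 1 \<longrightarrow>
            (\<forall>m\<in>pos_tuples r.
               real (num_cyclic_subgroups (cyclic_product r m)) =
                 (\<Sum>d\<in>(\<Pi>\<^sub>E i\<in>{1..r}. {k. k dvd m i}).
                    real (\<Prod>i=1..r. totient (d i)) / real (totient (LCM i\<in>{1..r}. d i)))) \<and>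
            multiplicative_function r (\<lambda>m. of_nat (num_cyclic_subgroups (cyclic_product r m)))) \<and>
         (\<forall>(m1::nat) (m2::nat). m1 \<ge> 1 \<longrightarrow> m2 \<ge> 1 \<longrightarrow>
            num_cyclic_subgroups (integer_mod_group m1 \<times>\<times> integer_mod_group m2) =
              (\<Sum>d1 | d1 dvd m1. \<Sum>d2 | d2 dvd m2. totient (gcd d1 d2))) \<and>
         (\<forall>(p::nat) (u::nat) (v::nat). prime p \<longrightarrow> v \<ge> 1 \<longrightarrow> u \<ge> v \<longrightarrow>
            num_cyclic_subgroups (integer_mod_group (p ^ u) \<times>\<times> integer_mod_group (p ^ v)) =
              2 * (\<Sum>i<v. p ^ i) + (u - v + 1) * p ^ v)"
proof (intro conjI allI impI ballI)
  fix r :: nat and m assume "m \<in> pos_tuples r"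
  then show "real (num_cyclic_subgroups (cyclic_product r m)) =
      (\<Sum>d\<in>(\<Pi>\<^sub>E i\<in>{1..r}. {k. k dvd m i}).
         real (\<Prod>i=1..r. totient (d i)) / real (totient (LCM i\<in>{1..r}. d i)))"
    by (intro num_cyclic_subgroups_cyclic_product) (auto simp: pos_tuples_def PiE_iff Suc_le_eq)
next
  fix p u v :: nat assume "prime p" "v \<le> u"
  \<comment> \<open>Indexing divisors by exponents turns the gcd formula into the double sum
    evaluated in \<open>sum_totient_gcd_prime_powers\<close>.\<close>
  then show "num_cyclic_subgroups (integer_mod_group (p ^ u) \<times>\<times> integer_mod_group (p ^ v)) =
      2 * (\<Sum>i<v. p ^ i) + (u - v + 1) * p ^ v"
    by (simp add: num_cyclic_subgroups_DirProd prime_gt_0_nat sum_dvd_prime_power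
        sum_totient_gcd_prime_powers)
qed (simp_all add: multiplicative_num_cyclic_subgroups num_cyclic_subgroups_DirProd)

end
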